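(* Let $Y$ be a vertex algebra structure on the chiral boson. Given finite sets $S_1,S_2\subset\mathbb P\setminus P$, states $\mathtt v_1\in{}_{S_1}\mathbf W$ and $\mathtt v_2\in{}_{S_2}\mathbf W$, and a translation $v$ with $S_2\cap(S_1+v)=\emptyset$ (so that both sides are defined), one has $$Y(\mathtt v_1,v)\mathtt v_2=\mathsf T_v\,Y(\mathtt v_2,-v)\mathtt v_1 .$$
   Context: Fix a point $P$ of a complex projective line $\mathbb P$. Translations are the automorphisms in the additive group ($\cong\mathbb C$) of translations of the affine line $\mathbb P\setminus P$; $z+v$ is the action of $v$ on $z$; in a coordinate $u$ with pole at $P$, $u(z+v)=u(z)+u(v)$. $\mathbf K$ is the space of meromorphic 1-forms on $\mathbb P$ with all residues zero, regular at $P$; $\mathbf W=S^*\mathbf K$, vacuum $\mathbf 1$. For a finite set $S\subset\mathbb P\setminus P$: ${}_S\mathbf W=S^*({}_S\mathbf K)$ with ${}_S\mathbf K\subset\mathbf K$ the forms with all poles in $S$; $\mathbf W^S=S^*(\mathbf K^S)$ with $\mathbf K^S\subset\mathbf K$ the forms regular at every point of $S$. $\mathsf T_v:\mathbf W\to\mathbf W$ is induced by $a(u)du\mapsto a(u-u(v))du$ and maps ${}_S\mathbf W$ to ${}_{S+v}\mathbf W$. For $O\ne P$ and $\lambda\in\mathbb C^*=\mathrm{Aut}_{O,P}(\mathbb P)$ acting by $u(\lambda(z))=\lambda u(z)$ (with $u(O)=0$, $u(P)=\infty$), $\mathsf R_\lambda$ is the operator on $\mathbf W$ induced by pull-back by $\lambda^{-1}$.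 A vertex algebra structure on the chiral boson is an assignment, linear in the state, to each finite set $S$, state $\mathtt v\in{}_S\mathbf W$ and translation $v$ of an operator $Y(\mathtt v,v):\mathbf W^{S+v}\to\mathbf W$ (compatible with enlarging $S$), such that: 1. if $\mathtt v'\in{}_{S'}\mathbf W\cap\mathbf W^{S+v}$ then $Y(\mathtt v,v)\mathtt v'\in{}_{S'\cup(S+v)}\mathbf W$; 2. $Y(\mathbf 1,v)=\mathrm{Id}$; 3. $Y(\mathtt v,0)\mathbf 1=\mathtt v$; 4. for $\mathtt v\in{}_S\mathbf W$, $\mathtt v'\in{}_{S'}\mathbf W$, the operators $Y(\mathtt v,v)$ and $Y(\mathtt v',v')$ commute if $S+v$ is disjoint from $S'+v'$ (where both compositions are defined); 5. $Y(\mathtt v,v+v')=\mathsf T_{v'}\circ Y(\mathtt v,v)\circ\mathsf T_{-v'}$ for translations $v,v'$; 6. $Y$ is $\mathrm{Aut}_P(\mathbb P)$-covariant: $Y(\mathsf T_{v'}\mathtt v,v)=\mathsf T_{v'}Y(\mathtt v,v)\mathsf T_{-v'}$ and $Y(\mathsf R_\lambda\mathtt v,\lambda v)=\mathsf R_\lambda Y(\mathtt v,v)\mathsf R_{\lambda^{-1}}$ for rotations $\lambda$ about any point $O$; 7. for a fixed point $O$, the vectors $Y(\mathtt v_n,v_n)\cdots Y(\mathtt v_1,v_1)\mathbf 1$, over all sequences of distinct translations $v_i$ and states $\mathtt v_i\in{}_{\{O\}}\mathbf W$, span $\mathbf W$. *)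

theory Defs
  imports
    "HOL-Complex_Analysis.Complex_Analysis"
    "HOL-Library.Multiset"
    "HOL-Library.Poly_Mapping"
begin

text \<open>
  Throughout, a coordinate \<open>u\<close> with pole at \<open>P\<close> is fixed. It identifies the affine line
  \<open>\<P> - P\<close> with the type \<^typ>\<open>complex\<close> and \<open>P\<close> with \<open>\<infinity>\<close>. A translation \<open>v\<close> is identified
  with the number \<open>u(v)\<close>, acting by \<open>z \<mapsto> z + v\<close>, and \<open>\<lambda> \<noteq> 0\<close> acts as the rotation
  \<open>z \<mapsto> p + \<lambda> (z - p)\<close> about the point \<open>p\<close>.
\<close>

section \<open>The space of 1-forms\<close>

text \<open>
  A meromorphic 1-form is written \<open>a(u) du\<close>. In the coordinate \<open>w = 1/u\<close> at \<open>P\<close> it is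
  \<open>- a(1/w) / w\<^sup>2 dw\<close>; having a finite limit at \<open>w = 0\<close> means (Riemann) that the form extends
  holomorphically over \<open>P\<close>, so in particular its residue at \<open>P\<close> vanishes.
\<close>
definition regular_at_P :: "(complex \<Rightarrow> complex) \<Rightarrow> bool" where
  "regular_at_P a \<longleftrightarrow> (\<exists>c. ((\<lambda>w. - a (inverse w) / w ^ 2) \<longlongrightarrow> c) (at 0))"

text \<open>
  Coefficient functions are normalised by \<^const>\<open>nicely_meromorphic_on\<close> (removable singularities
  removed, value 0 at poles), so that equal forms are equal as functions.
\<close>
definition K_coeffs :: "(complex \<Rightarrow> complex) set" where
  "K_coeffs = {a. a nicely_meromorphic_on UNIV \<and> (\<forall>z. residue a z = 0) \<and> regular_at_P a}"

lemma nicely_meromorphic_remove_sings: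
  assumes "f nicely_meromorphic_on UNIV"
  shows "remove_sings f = f"
proof
  fix z
  have "(is_pole f z \<and> f z = 0) \<or> f \<midarrow>z\<rightarrow> f z"
    using assms by (auto simp: nicely_meromorphic_on_def)
  thus "remove_sings f z = f z" by auto
qed

lemma nicely_meromorphic_eqI:
  assumes "f nicely_meromorphic_on UNIV" "g nicely_meromorphic_on UNIV"
    and "\<And>z. eventually (\<lambda>u. f u = g u) (at z)"
  shows "f = g"
proof -
  have "remove_sings f z = remove_sings g z" for z
    by (rule remove_sings_cong) (use assms in auto)
  thus ?thesis
    using assms nicely_meromorphic_remove_sings by (metis ext)
qed

lemma nicely_meromorphic_isolated:
  "f nicely_meromorphic_on UNIV \<Longrightarrow> isolated_singularity_at f z"
  unfolding nicely_meromorphic_on_def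
  by (meson UNIV_I meromorphic_on_isolated_singularity meromorphic_on_subset subset_UNIV)

lemma remove_sings_add_nice:
  assumes "f nicely_meromorphic_on UNIV" "g nicely_meromorphic_on UNIV"
  shows "remove_sings (\<lambda>u. f u + g u) nicely_meromorphic_on UNIV"
    and "eventually (\<lambda>u. remove_sings (\<lambda>u. f u + g u) u = f u + g u) (at z)"
proof -
  have mero: "(\<lambda>u. f u + g u) meromorphic_on UNIV"
    using assms by (auto simp: nicely_meromorphic_on_def intro!: meromorphic_intros)
  show "remove_sings (\<lambda>u. f u + g u) nicely_meromorphic_on UNIV"
    by (rule remove_sings_nicely_meromorphic) (rule mero)
  show "eventually (\<lambda>u. remove_sings (\<lambda>u. f u + g u) u = f u + g u) (at z)"
    by (rule eventually_remove_sings_eq_at)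
       (rule meromorphic_on_isolated_singularity[OF meromorphic_on_subset[OF mero]], auto)
qed

lemma regular_at_P_imp_analytic:
  assumes "f nicely_meromorphic_on UNIV" "regular_at_P f"
  shows "eventually (\<lambda>w. f analytic_on {inverse w}) (at 0)"
proof -
  obtain c where c: "((\<lambda>w. - f (inverse w) / w ^ 2) \<longlongrightarrow> c) (at 0)"
    using assms(2) by (auto simp: regular_at_P_def)
  hence "eventually (\<lambda>w. norm (- f (inverse w) / w ^ 2) < norm c + 1) (at 0)"
    using order_tendstoD(2)[OF tendsto_norm[OF c]] by force
  then obtain r where r: "r > 0"
    "\<And>w. w \<noteq> 0 \<Longrightarrow> norm w < r \<Longrightarrow> norm (- f (inverse w) / w ^ 2) < norm c + 1"
    by (auto simp: eventually_at dist_norm)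
  have "f analytic_on {inverse w}" if w: "w \<in> ball 0 r - {0}" for w
  proof (rule nicely_meromorphic_on_imp_analytic_at[OF assms(1)])
    show "\<not> is_pole f (inverse w)"
    proof
      assume "is_pole f (inverse w)"
      moreover have "inverse \<midarrow>w\<rightarrow> inverse w"
        using w by (intro tendsto_intros) auto
      moreover have "eventually (\<lambda>x. inverse x \<noteq> inverse w) (at w)"
        by (auto simp: eventually_at intro!: exI[of _ 1])
      ultimately have "is_pole (\<lambda>x. f (inverse x)) w"
        by (rule is_pole_compose)
      hence "filterlim (\<lambda>x. f (inverse x)) at_infinity (at w)"
        by (simp add: is_pole_def)
      hence "eventually (\<lambda>x. norm (f (inverse x)) \<ge> (norm c + 1) * r ^ 2) (at w)"
        by (auto simp: filterlim_at_infinity[OF order_refl] intro: add_nonneg_pos r)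
           (use r in \<open>metis add_nonneg_pos mult_pos_pos norm_ge_zero zero_less_one zero_less_power\<close>)
      moreover have "eventually (\<lambda>x. x \<in> ball 0 r - {0}) (at w)"
        using w by (intro eventually_at_in_open') auto
      ultimately have "eventually (\<lambda>x::complex. False) (at w)"
      proof eventually_elim
        case (elim x)
        have "norm (f (inverse x)) / norm x ^ 2 < norm c + 1"
          using r(2)[of x] elim by (simp add: norm_divide norm_power)
        hence "norm (f (inverse x)) < (norm c + 1) * norm x ^ 2"
          using elim by (simp add: field_simps)
        also have "\<dots> \<le> (norm c + 1) * r ^ 2"
          using elim by (intro mult_left_mono power_mono) auto
        finally show ?case using elim by simp
      qed
      thus False by simp
    qed
  qed auto
  moreover have "eventually (\<lambda>w. w \<in> ball 0 r - {0}) (at (0::complex))"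
    using r by (intro eventually_at_in_open) auto
  ultimately show ?thesis by (auto elim: eventually_mono)
qed

lemma K_coeffs_zero: "(\<lambda>_. 0) \<in> K_coeffs"
  by (auto simp: K_coeffs_def regular_at_P_def residue_const)

lemma K_coeffs_add:
  assumes "f \<in> K_coeffs" "g \<in> K_coeffs"
  shows "remove_sings (\<lambda>u. f u + g u) \<in> K_coeffs"
  unfolding K_coeffs_def mem_Collect_eq
proof (intro conjI allI)
  have fg: "f nicely_meromorphic_on UNIV" "g nicely_meromorphic_on UNIV"
    using assms by (auto simp: K_coeffs_def)
  show "remove_sings (\<lambda>u. f u + g u) nicely_meromorphic_on UNIV"
    by (rule remove_sings_add_nice) fact+
  show "residue (remove_sings (\<lambda>u. f u + g u)) z = 0" for z
  proof -
    obtain r s where rs: "r > 0" "f analytic_on ball z r - {z}" "s > 0" "g analytic_on ball z s - {z}"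
      using fg[THEN nicely_meromorphic_isolated, of z] by (auto simp: isolated_singularity_at_def)
    have "residue (remove_sings (\<lambda>u. f u + g u)) z = residue (\<lambda>u. f u + g u) z"
      by (rule residue_cong) (use remove_sings_add_nice(2)[OF fg] in auto)
    also have "\<dots> = residue f z + residue g z"
      using rs by (intro residue_add[of "ball z (min r s)"])
        (auto intro!: analytic_imp_holomorphic elim: analytic_on_subset)
    finally show ?thesis using assms by (simp add: K_coeffs_def)
  qed
  show "regular_at_P (remove_sings (\<lambda>u. f u + g u))"
  proof -
    obtain c d where "((\<lambda>w. - f (inverse w) / w ^ 2) \<longlongrightarrow> c) (at 0)"
        "((\<lambda>w. - g (inverse w) / w ^ 2) \<longlongrightarrow> d) (at 0)"
      using assms by (auto simp: K_coeffs_def regular_at_P_def)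
    hence "((\<lambda>w. - f (inverse w) / w ^ 2 + - g (inverse w) / w ^ 2) \<longlongrightarrow> c + d) (at 0)"
      by (intro tendsto_add)
    moreover have "eventually (\<lambda>w. f analytic_on {inverse w}) (at 0)"
      "eventually (\<lambda>w. g analytic_on {inverse w}) (at 0)"
      using assms by (auto intro!: regular_at_P_imp_analytic simp: K_coeffs_def)
    hence "eventually (\<lambda>w. - f (inverse w) / w ^ 2 + - g (inverse w) / w ^ 2 =
             - remove_sings (\<lambda>u. f u + g u) (inverse w) / w ^ 2) (at 0)"
    proof eventually_elim
      case (elim w)
      have "(\<lambda>u. f u + g u) analytic_on {inverse w}"
        using elim by (intro analytic_intros)
      thus ?case by (simp add: diff_divide_distrib)
    qed
    ultimately have "((\<lambda>w. - remove_sings (\<lambda>u. f u + g u) (inverse w) / w ^ 2) \<longlongrightarrow> c + d) (at 0)"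
      by (rule Lim_transform_eventually)
    thus ?thesis
      unfolding regular_at_P_def by blast
  qed
qed

lemma K_coeffs_cmult:
  assumes "f \<in> K_coeffs"
  shows "(\<lambda>u. c * f u) \<in> K_coeffs"
  unfolding K_coeffs_def mem_Collect_eq
proof (intro conjI allI)
  show "(\<lambda>u. c * f u) nicely_meromorphic_on UNIV"
    using assms by (auto simp: K_coeffs_def)
  show "residue (\<lambda>u. c * f u) z = 0" for z
  proof -
    have "f nicely_meromorphic_on UNIV"
      using assms by (auto simp: K_coeffs_def)
    then obtain r where r: "r > 0" "f analytic_on ball z r - {z}"
      using nicely_meromorphic_isolated[of f z] by (auto simp: isolated_singularity_at_def)
    have "residue (\<lambda>u. c * f u) z = c * residue f z"
      using r by (intro residue_lmul[of "ball z r"]) (auto intro: analytic_imp_holomorphic)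
    thus ?thesis using assms by (simp add: K_coeffs_def)
  qed
  obtain d where d: "((\<lambda>w. - f (inverse w) / w ^ 2) \<longlongrightarrow> d) (at 0)"
    using assms by (auto simp: K_coeffs_def regular_at_P_def)
  have "((\<lambda>w. - (c * f (inverse w)) / w ^ 2) \<longlongrightarrow> c * d) (at 0)"
    using tendsto_mult_left[OF d, of c] by simp
  thus "regular_at_P (\<lambda>u. c * f u)"
    by (auto simp: regular_at_P_def)
qed

lemma K_coeffs_affine:
  assumes "f \<in> K_coeffs"
  shows "(\<lambda>u. m * f (m * u + b)) \<in> K_coeffs"
proof (cases "m = 0")
  case True
  thus ?thesis by (simp add: K_coeffs_zero)
next
  case m: False
  let ?g = "\<lambda>u. m * u + b"
  have f: "f nicely_meromorphic_on UNIV"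
    using assms by (auto simp: K_coeffs_def)
  have ev: "eventually (\<lambda>u. ?g u \<noteq> ?g z) (at z)" for z
    using m by (auto simp: eventually_at intro!: exI[of _ 1])
  have lim: "?g \<midarrow>z\<rightarrow> ?g z" for z
    by (intro tendsto_intros)
  have "(\<lambda>u. f (?g u)) nicely_meromorphic_on UNIV"
    unfolding nicely_meromorphic_on_def
  proof (intro conjI ballI)
    show "(\<lambda>u. f (?g u)) meromorphic_on UNIV"
      by (rule meromorphic_on_compose[of f UNIV])
         (use f in \<open>auto simp: nicely_meromorphic_on_def intro!: analytic_intros\<close>)
    fix z
    have "(is_pole f (?g z) \<and> f (?g z) = 0) \<or> f \<midarrow>?g z\<rightarrow> f (?g z)"
      using f by (auto simp: nicely_meromorphic_on_def)
    thus "(is_pole (\<lambda>u. f (?g u)) z \<and> f (?g z) = 0) \<or> (\<lambda>u. f (?g u)) \<midarrow>z\<rightarrow> f (?g z)"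
    proof (elim disjE conjE)
      assume "is_pole f (?g z)" "f (?g z) = 0"
      thus ?thesis using is_pole_compose[OF _ lim ev] by blast
    next
      assume "f \<midarrow>?g z\<rightarrow> f (?g z)"
      hence "(\<lambda>u. f (?g u)) \<midarrow>z\<rightarrow> f (?g z)"
        by (rule filterlim_compose) (use lim ev in \<open>auto simp: filterlim_at\<close>)
      thus ?thesis ..
    qed
  qed
  moreover have "residue (\<lambda>u. f (?g u)) z = 0" for z
  proof -
    have "f meromorphic_on {?g z}"
      using f by (auto simp: nicely_meromorphic_on_def intro: meromorphic_on_subset)
    then obtain F where F: "(\<lambda>w. f (?g z + w)) has_laurent_expansion F"
      by (auto simp: meromorphic_on_def)
    have F0: "fls_nth F (-1) = 0"
      using has_laurent_expansion_residue[OF F] assms by (simp add: K_coeffs_def)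
    have "(\<lambda>w. m * w) has_fps_expansion (fps_const m * fps_X)"
      by (intro fps_expansion_intros)
    hence "(\<lambda>w. m * w) has_laurent_expansion fps_to_fls (fps_const m * fps_X)"
      by (rule has_laurent_expansion_fps)
    hence "((\<lambda>w. f (?g z + w)) \<circ> (\<lambda>w. m * w)) has_laurent_expansion
             fls_compose_fps F (fps_const m * fps_X)"
      using m by (intro has_laurent_expansion_compose[OF F]) auto
    hence "(\<lambda>w. f (?g (z + w))) has_laurent_expansion fls_compose_fps F (fps_const m * fps_X)"
      by (simp add: o_def algebra_simps)
    from has_laurent_expansion_residue[OF this] show ?thesis
      using m F0 by (simp add: fls_nth_fls_compose_fps_linear)
  qed
  moreover have "regular_at_P (\<lambda>u. f (?g u))"
  proof -
    obtain c where c: "((\<lambda>w. - f (inverse w) / w ^ 2) \<longlongrightarrow> c) (at 0)"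
      using assms by (auto simp: K_coeffs_def regular_at_P_def)
    let ?h = "\<lambda>w. w / (m + b * w)"
    have "((\<lambda>w. m + b * w) \<longlongrightarrow> m + b * 0) (at 0)"
      by (intro tendsto_intros)
    hence lim0: "((\<lambda>w. m + b * w) \<longlongrightarrow> m) (at 0)" by simp
    hence ev0: "eventually (\<lambda>w. m + b * w \<noteq> 0) (at 0)"
      using m tendsto_imp_eventually_ne by blast
    have "(?h \<longlongrightarrow> 0 / m) (at 0)"
      by (rule tendsto_divide[OF _ lim0 m]) (rule tendsto_ident_at)
    moreover have ev1: "eventually (\<lambda>w. w \<noteq> (0::complex)) (at 0)"
      by (auto simp: eventually_at intro!: exI[of _ 1])
    hence "eventually (\<lambda>w. ?h w \<noteq> 0) (at 0)"
      using ev0 by eventually_elim auto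
    ultimately have "filterlim ?h (at 0) (at 0)"
      by (auto simp: filterlim_at)
    from filterlim_compose[OF c this]
    have "((\<lambda>w. - f (inverse (?h w)) / ?h w ^ 2) \<longlongrightarrow> c) (at 0)" .
    hence "((\<lambda>w. - f (inverse (?h w)) / ?h w ^ 2 / (m + b * w) ^ 2) \<longlongrightarrow> c / m ^ 2) (at 0)"
      by (intro tendsto_intros lim0) (use m in auto)
    moreover have "eventually (\<lambda>w. - f (inverse (?h w)) / ?h w ^ 2 / (m + b * w) ^ 2 =
        - f (?g (inverse w)) / w ^ 2) (at 0)"
      using ev0 ev1
    proof eventually_elim
      case (elim w)
      have "inverse (?h w) = ?g (inverse w)"
        using elim by (simp add: field_simps)
      thus ?case using elim by (simp add: power_divide)
    qed
    ultimately have "((\<lambda>w. - f (?g (inverse w)) / w ^ 2) \<longlongrightarrow> c / m ^ 2) (at 0)"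
      by (rule Lim_transform_eventually)
    thus ?thesis
      unfolding regular_at_P_def by blast
  qed
  ultimately have "(\<lambda>u. f (?g u)) \<in> K_coeffs"
    by (simp add: K_coeffs_def)
  thus ?thesis by (rule K_coeffs_cmult)
qed

typedef kform = K_coeffs
  morphisms coeff_fun Abs_kform
  using K_coeffs_zero by blast

setup_lifting type_definition_kform

instantiation kform :: ab_group_add
begin

lift_definition zero_kform :: kform is "\<lambda>_. 0"
  by (rule K_coeffs_zero)

lift_definition plus_kform :: "kform \<Rightarrow> kform \<Rightarrow> kform"
  is "\<lambda>f g. remove_sings (\<lambda>u. f u + g u)"
  by (rule K_coeffs_add)

lift_definition uminus_kform :: "kform \<Rightarrow> kform" is "\<lambda>f u. - f u"
  using K_coeffs_cmult[of _ "-1"] by simp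

definition minus_kform :: "kform \<Rightarrow> kform \<Rightarrow> kform" where
  "minus_kform a b = a + (- b)"

instance
proof
  fix a b c :: kform
  show "a + b + c = a + (b + c)"
  proof (transfer, goal_cases)
    case (1 f g h)
    hence n: "f nicely_meromorphic_on UNIV" "g nicely_meromorphic_on UNIV" "h nicely_meromorphic_on UNIV"
      by (auto simp: K_coeffs_def)
    note n' = remove_sings_add_nice(1)[OF n(1,2)] remove_sings_add_nice(1)[OF n(2,3)]
    show ?case
    proof (rule nicely_meromorphic_eqI)
      fix z
      show "\<forall>\<^sub>F u in at z.
          remove_sings (\<lambda>u. remove_sings (\<lambda>u. f u + g u) u + h u) u =
          remove_sings (\<lambda>u. f u + remove_sings (\<lambda>u. g u + h u) u) u"
        using remove_sings_add_nice(2)[OF n(1,2), of z] remove_sings_add_nice(2)[OF n(2,3), of z]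
          remove_sings_add_nice(2)[OF n'(1) n(3), of z] remove_sings_add_nice(2)[OF n(1) n'(2), of z]
        by eventually_elim simp
    qed (rule remove_sings_add_nice n n')+
  qed
  show "a + b = b + a"
    by transfer (simp add: add.commute)
  show "0 + a = a"
    by transfer (simp add: nicely_meromorphic_remove_sings K_coeffs_def)
  show "- a + a = 0"
    by transfer auto
  show "a - b = a + - b"
    by (rule minus_kform_def)
qed

end

lift_definition kform_scale :: "complex \<Rightarrow> kform \<Rightarrow> kform" is "\<lambda>c f u. c * f u"
  by (rule K_coeffs_cmult)

text \<open>
  Pull-back of \<open>a(u) du\<close> along \<open>u \<mapsto> m u + b\<close>. For \<open>m \<noteq> 0\<close> these are the automorphisms of
  \<open>\<P>\<close> fixing \<open>P\<close>; for \<open>m = 0\<close> the value is the zero form.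
\<close>
lift_definition kform_pullback :: "complex \<Rightarrow> complex \<Rightarrow> kform \<Rightarrow> kform"
  is "\<lambda>m b f u. m * f (m * u + b)"
  by (rule K_coeffs_affine)

lemma kform_eqI:
  assumes "\<And>z. eventually (\<lambda>u. coeff_fun a u = coeff_fun b u) (at z)"
  shows "a = b"
proof -
  have "coeff_fun a = coeff_fun b"
    by (rule nicely_meromorphic_eqI)
       (use assms coeff_fun[of a] coeff_fun[of b] in \<open>auto simp: K_coeffs_def\<close>)
  thus ?thesis by (simp add: coeff_fun_inject)
qed

lemma eventually_coeff_fun_add:
  "eventually (\<lambda>u. coeff_fun (a + b) u = coeff_fun a u + coeff_fun b u) (at z)"
  using remove_sings_add_nice(2)[of "coeff_fun a" "coeff_fun b" z]
    coeff_fun[of a] coeff_fun[of b]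
  by (simp add: plus_kform.rep_eq K_coeffs_def)

interpretation kform: vector_space kform_scale
proof
  fix c d :: complex and a b :: kform
  show "kform_scale c (a + b) = kform_scale c a + kform_scale c b"
  proof (rule kform_eqI)
    fix z
    show "\<forall>\<^sub>F u in at z. coeff_fun (kform_scale c (a + b)) u =
            coeff_fun (kform_scale c a + kform_scale c b) u"
      using eventually_coeff_fun_add[of a b z]
        eventually_coeff_fun_add[of "kform_scale c a" "kform_scale c b" z]
      by eventually_elim (simp add: kform_scale.rep_eq algebra_simps)
  qed
  show "kform_scale (c + d) a = kform_scale c a + kform_scale d a"
  proof (rule kform_eqI)
    fix z
    show "\<forall>\<^sub>F u in at z. coeff_fun (kform_scale (c + d) a) u =
            coeff_fun (kform_scale c a + kform_scale d a) u"
      using eventually_coeff_fun_add[of "kform_scale c a" "kform_scale d a" z]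
      by eventually_elim (simp add: kform_scale.rep_eq algebra_simps)
  qed
  show "kform_scale c (kform_scale d a) = kform_scale (c * d) a"
    by transfer (simp add: mult.assoc)
  show "kform_scale 1 a = a"
    by transfer simp
qed

lemma kform_pullback_scale:
  "kform_pullback m b (kform_scale c a) = kform_scale c (kform_pullback m b a)"
  by transfer (simp add: mult_ac)

lemma kform_pullback_add:
  "kform_pullback m b (x + y) = kform_pullback m b x + kform_pullback m b y"
proof (cases "m = 0")
  case True
  hence "kform_pullback m b z = 0" for z
    by transfer simp
  thus ?thesis by simp
next
  case m: False
  show ?thesis
  proof (rule kform_eqI)
    fix z
    have "filterlim (\<lambda>u. m * u + b) (at (m * z + b)) (at z)"
      unfolding filterlim_at using m
      by (auto simp: eventually_at intro!: exI[of _ 1] tendsto_intros)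
    hence "\<forall>\<^sub>F u in at z. coeff_fun (x + y) (m * u + b) =
             coeff_fun x (m * u + b) + coeff_fun y (m * u + b)"
      using eventually_coeff_fun_add[of x y "m * z + b"]
      by (auto dest: eventually_compose_filterlim)
    thus "\<forall>\<^sub>F u in at z. coeff_fun (kform_pullback m b (x + y)) u =
            coeff_fun (kform_pullback m b x + kform_pullback m b y) u"
      using eventually_coeff_fun_add[of "kform_pullback m b x" "kform_pullback m b y" z]
      by eventually_elim (simp add: kform_pullback.rep_eq algebra_simps)
  qed
qed


lifting_forget kform.lifting


section \<open>The symmetric algebra\<close>

text \<open>
  \<open>\<W> = S\<^sup>*K\<close> is the free commutative \<open>\<complex>\<close>-algebra on the set \<open>K\<close> (the monoid algebra of the
  multisets over \<open>K\<close>) modulo the ideal that makes the generators depend linearly on \<open>K\<close>.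
\<close>

lemma ring_module: "module ((*) :: 'a::comm_ring_1 \<Rightarrow> 'a \<Rightarrow> 'a)"
  by standard (simp_all add: algebra_simps)

definition sym_relators :: "(kform multiset \<Rightarrow>\<^sub>0 complex) set" where
  "sym_relators =
     {Poly_Mapping.single {#a + b#} 1 - Poly_Mapping.single {#a#} 1 - Poly_Mapping.single {#b#} 1 | a b. True}
   \<union> {Poly_Mapping.single {#kform_scale c a#} 1 - Poly_Mapping.single {#a#} c | c a. True}"

definition sym_ideal :: "(kform multiset \<Rightarrow>\<^sub>0 complex) set" where
  "sym_ideal = module.span (*) sym_relators"

definition sym_eq :: "(kform multiset \<Rightarrow>\<^sub>0 complex) \<Rightarrow> (kform multiset \<Rightarrow>\<^sub>0 complex) \<Rightarrow> bool" where
  "sym_eq x y \<longleftrightarrow> x - y \<in> sym_ideal"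

lemma sym_ideal_zero: "0 \<in> sym_ideal"
  and sym_ideal_add: "x \<in> sym_ideal \<Longrightarrow> y \<in> sym_ideal \<Longrightarrow> x + y \<in> sym_ideal"
  and sym_ideal_uminus: "x \<in> sym_ideal \<Longrightarrow> - x \<in> sym_ideal"
  and sym_ideal_mult: "x \<in> sym_ideal \<Longrightarrow> r * x \<in> sym_ideal"
  and sym_ideal_relator: "x \<in> sym_relators \<Longrightarrow> x \<in> sym_ideal"
  unfolding sym_ideal_def
  by (auto intro: module.span_zero[OF ring_module] module.span_add[OF ring_module] module.span_neg[OF ring_module] module.span_scale[OF ring_module]
      module.span_base[OF ring_module])

lemma sym_eq_refl: "sym_eq x x"
  by (simp add: sym_eq_def sym_ideal_zero)

lemma sym_eq_equivp: "equivp sym_eq"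
proof (rule equivpI)
  show "reflp sym_eq"
    by (auto simp: reflp_def sym_eq_refl)
  show "symp sym_eq"
    by (rule sympI) (use sym_ideal_uminus in \<open>force simp: sym_eq_def\<close>)
  show "transp sym_eq"
    by (rule transpI) (use sym_ideal_add in \<open>force simp: sym_eq_def\<close>)
qed

quotient_type boson = "kform multiset \<Rightarrow>\<^sub>0 complex" / sym_eq
  by (rule sym_eq_equivp)

lemma poly_mapping_single_induct [case_names single add]:
  assumes "\<And>k c. P (Poly_Mapping.single k c)" "\<And>p q. P p \<Longrightarrow> P q \<Longrightarrow> P (p + q)"
  shows "P (p :: 'a \<Rightarrow>\<^sub>0 'b::comm_monoid_add)"
proof -
  have P0: "P 0"
    using assms(1)[of undefined 0] by simp
  have "P (\<Sum>k\<in>A. Poly_Mapping.single k (Poly_Mapping.lookup p k))" if "finite A" for A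
    using that by induction (auto intro: assms P0)
  from this[of "Poly_Mapping.keys p"]
  have "P (\<Sum>k\<in>Poly_Mapping.keys p. Poly_Mapping.single k (Poly_Mapping.lookup p k))"
    by simp
  also have "(\<Sum>k\<in>Poly_Mapping.keys p. Poly_Mapping.single k (Poly_Mapping.lookup p k)) = p"
    by (rule poly_mapping_eqI)
       (auto simp: lookup_sum lookup_single when_def in_keys_iff)
  finally show ?thesis .
qed

lemma lookup_mult_empty:
  "Poly_Mapping.lookup (p * q) {#} = Poly_Mapping.lookup p {#} * Poly_Mapping.lookup q {#}"
  for p q :: "'a multiset \<Rightarrow>\<^sub>0 complex"
proof (induction p rule: poly_mapping_single_induct)
  case (single k c)
  show ?case
    by (induction q rule: poly_mapping_single_induct)
       (auto simp: mult_single lookup_single when_def lookup_add algebra_simps)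
next
  case (add p q)
  thus ?case by (simp add: lookup_add algebra_simps)
qed

lemma lookup_sym_ideal_empty: "x \<in> sym_ideal \<Longrightarrow> Poly_Mapping.lookup x {#} = 0"
  unfolding sym_ideal_def
proof (induction x rule: module.span_induct_alt[OF ring_module, consumes 1, case_names base step])
  case base
  show ?case by simp
next
  case (step c x y)
  from step(1) have "Poly_Mapping.lookup x {#} = 0"
    by (auto simp: sym_relators_def lookup_minus lookup_single)
  with step show ?case by (simp add: lookup_add lookup_mult_empty)
qed

lemma single_empty_one: "Poly_Mapping.single {#} 1 = 1"
  using single_one[where 'a = "'a multiset"] by simp

lemma abs_boson_cases: "\<exists>p. x = abs_boson p"
  by (rule exI[of _ "rep_boson x"]) (simp add: Quotient3_abs_rep[OF Quotient3_boson])

instantiation boson :: comm_ring_1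
begin

lift_definition zero_boson :: boson is 0 .

lift_definition one_boson :: boson is 1 .

lift_definition plus_boson :: "boson \<Rightarrow> boson \<Rightarrow> boson" is "(+)"
  unfolding sym_eq_def by (subst add_diff_add) (rule sym_ideal_add)

lift_definition uminus_boson :: "boson \<Rightarrow> boson" is uminus
  unfolding sym_eq_def by (subst minus_diff_minus) (rule sym_ideal_uminus)

lift_definition minus_boson :: "boson \<Rightarrow> boson \<Rightarrow> boson" is "(-)"
proof -
  fix p q p' q' :: "kform multiset \<Rightarrow>\<^sub>0 complex"
  assume "sym_eq p p'" "sym_eq q q'"
  hence "(p - p') + - (q - q') \<in> sym_ideal"
    unfolding sym_eq_def by (intro sym_ideal_add sym_ideal_uminus)
  thus "sym_eq (p - q) (p' - q')"
    by (simp add: sym_eq_def algebra_simps)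
qed

lift_definition times_boson :: "boson \<Rightarrow> boson \<Rightarrow> boson" is "(*)"
proof -
  fix p q p' q' :: "kform multiset \<Rightarrow>\<^sub>0 complex"
  assume "sym_eq p p'" "sym_eq q q'"
  hence "q * (p - p') + p' * (q - q') \<in> sym_ideal"
    unfolding sym_eq_def by (intro sym_ideal_add sym_ideal_mult)
  thus "sym_eq (p * q) (p' * q')"
    by (simp add: sym_eq_def algebra_simps)
qed

instance
proof
  fix a b c :: boson
  show "(0::boson) \<noteq> 1"
  proof
    assume "(0::boson) = 1"
    hence "sym_eq 0 1"
      by (simp add: zero_boson.abs_eq one_boson.abs_eq boson.abs_eq_iff)
    hence "Poly_Mapping.lookup (0 - 1 :: kform multiset \<Rightarrow>\<^sub>0 complex) {#} = 0"
      unfolding sym_eq_def by (rule lookup_sym_ideal_empty)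
    thus False
      by (simp add: lookup_minus lookup_one)
  qed
  obtain p q r where abs: "a = abs_boson p" "b = abs_boson q" "c = abs_boson r"
    using abs_boson_cases[of a] abs_boson_cases[of b] abs_boson_cases[of c] by blast
  note eqs = plus_boson.abs_eq uminus_boson.abs_eq minus_boson.abs_eq times_boson.abs_eq
    zero_boson.abs_eq one_boson.abs_eq
  show "a * b * c = a * (b * c)" by (simp only: abs eqs mult.assoc)
  show "a * b = b * a" by (simp only: abs eqs mult.commute)
  show "1 * a = a" by (simp only: abs eqs mult_1_left)
  show "a + b + c = a + (b + c)" by (simp only: abs eqs add.assoc)
  show "a + b = b + a" by (simp only: abs eqs add.commute)
  show "0 + a = a" by (simp only: abs eqs add_0_left)
  show "- a + a = 0" by (simp only: abs eqs left_minus)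
  show "a - b = a + - b" by (simp only: abs eqs diff_conv_add_uminus)
  show "(a + b) * c = a * c + b * c" by (simp only: abs eqs distrib_right)
qed

end

lift_definition kgen :: "kform \<Rightarrow> boson" is "\<lambda>a. Poly_Mapping.single {#a#} 1" .

lift_definition boson_scale :: "complex \<Rightarrow> boson \<Rightarrow> boson" is "\<lambda>c p. Poly_Mapping.single {#} c * p"
  unfolding sym_eq_def by (subst right_diff_distrib[symmetric]) (rule sym_ideal_mult)

interpretation boson: vector_space boson_scale
proof
  fix c d :: complex and x y :: boson
  obtain p q where abs: "x = abs_boson p" "y = abs_boson q"
    using abs_boson_cases[of x] abs_boson_cases[of y] by blast
  note eqs = plus_boson.abs_eq boson_scale.abs_eq
  show "boson_scale c (x + y) = boson_scale c x + boson_scale c y"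
    by (simp only: abs eqs distrib_left)
  show "boson_scale (c + d) x = boson_scale c x + boson_scale d x"
    by (simp only: abs eqs single_add distrib_right)
  show "boson_scale c (boson_scale d x) = boson_scale (c * d) x"
    by (simp only: abs eqs mult.assoc[symmetric] mult_single empty_neutral)
  show "boson_scale 1 x = x"
    by (simp only: abs eqs single_empty_one mult_1_left)
qed

lemma kgen_add: "kgen (a + b) = kgen a + kgen b"
proof -
  have "Poly_Mapping.single {#a + b#} 1 - Poly_Mapping.single {#a#} 1 - Poly_Mapping.single {#b#} 1 \<in> sym_ideal"
    by (rule sym_ideal_relator) (auto simp: sym_relators_def)
  thus ?thesis
    by (simp add: kgen.abs_eq plus_boson.abs_eq boson.abs_eq_iff sym_eq_def diff_diff_add)
qed

lemma kgen_scale: "kgen (kform_scale c a) = boson_scale c (kgen a)"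
proof -
  have "Poly_Mapping.single {#kform_scale c a#} 1 - Poly_Mapping.single {#a#} c \<in> sym_ideal"
    by (rule sym_ideal_relator) (auto simp: sym_relators_def)
  thus ?thesis
    by (simp add: kgen.abs_eq boson_scale.abs_eq boson.abs_eq_iff sym_eq_def mult_single)
qed

text \<open>
  For a subspace \<open>A\<close> of \<open>K\<close>, the algebra \<open>S\<^sup>*A\<close> is identified with its image in \<open>S\<^sup>*K\<close> (the map
  is injective over a field): the span of all products of elements of \<open>A\<close>.
\<close>
definition sym_sub :: "kform set \<Rightarrow> boson set" where
  "sym_sub A = boson.span {prod_mset (image_mset kgen M) | M. set_mset M \<subseteq> A}"

text \<open>The spaces \<open>\<^sub>S\<W>\<close> and \<open>\<W>\<^sup>S\<close>.\<close>

definition W_poles_in :: "complex set \<Rightarrow> boson set" where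
  "W_poles_in S = sym_sub {a. \<forall>z. is_pole (coeff_fun a) z \<longrightarrow> z \<in> S}"

definition W_regular_on :: "complex set \<Rightarrow> boson set" where
  "W_regular_on S = sym_sub {a. \<forall>z\<in>S. \<not> is_pole (coeff_fun a) z}"


section \<open>The action of the automorphisms\<close>

definition push :: "('a \<Rightarrow> 'b) \<Rightarrow> ('a multiset \<Rightarrow>\<^sub>0 complex) \<Rightarrow> ('b multiset \<Rightarrow>\<^sub>0 complex)" where
  "push f p =
     (\<Sum>M\<in>Poly_Mapping.keys p. Poly_Mapping.single (image_mset f M) (Poly_Mapping.lookup p M))"

lemma push_single [simp]:
  "push f (Poly_Mapping.single M c) = Poly_Mapping.single (image_mset f M) c"
  by (simp add: push_def)

lemma push_add: "push f (p + q) = push f p + push f q"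
  unfolding push_def by (rule setsum_keys_plus_distrib) (auto simp: single_add)

lemma push_zero [simp]: "push f 0 = 0"
  by (simp add: push_def)

lemma push_uminus: "push f (- p) = - push f p"
  using push_add[of f p "- p"] by (simp add: eq_neg_iff_add_eq_0 add.commute)

lemma push_diff: "push f (p - q) = push f p - push f q"
  using push_add[of f p "- q"] by (simp add: push_uminus)

lemma push_mult: "push f (p * q) = push f p * push f q"
proof (induction p rule: poly_mapping_single_induct)
  case (single k c)
  show ?case
    by (induction q rule: poly_mapping_single_induct)
       (simp_all add: mult_single push_add algebra_simps)
next
  case (add p q)
  thus ?case by (simp add: push_add algebra_simps)
qed

lemma push_pullback_sym_ideal:
  "x \<in> sym_ideal \<Longrightarrow> push (kform_pullback m b) x \<in> sym_ideal"
  unfolding sym_ideal_def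
proof (induction x rule: module.span_induct_alt[OF ring_module, consumes 1, case_names base step])
  case base
  show ?case by (simp add: module.span_zero[OF ring_module])
next
  case (step c x y)
  from step(1) have "push (kform_pullback m b) x \<in> sym_relators"
    unfolding sym_relators_def
  proof (elim UnE CollectE exE conjE)
    fix a a' assume "x = Poly_Mapping.single {#a + a'#} 1 - Poly_Mapping.single {#a#} 1 - Poly_Mapping.single {#a'#} 1"
    thus "push (kform_pullback m b) x \<in>
       {Poly_Mapping.single {#a + b#} 1 - Poly_Mapping.single {#a#} 1 - Poly_Mapping.single {#b#} 1 | a b. True}
     \<union> {Poly_Mapping.single {#kform_scale c a#} 1 - Poly_Mapping.single {#a#} c | c a. True}"
      by (intro UnI1) (auto simp: push_diff kform_pullback_add)
  next
    fix d a assume "x = Poly_Mapping.single {#kform_scale d a#} 1 - Poly_Mapping.single {#a#} d"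
    thus "push (kform_pullback m b) x \<in>
       {Poly_Mapping.single {#a + b#} 1 - Poly_Mapping.single {#a#} 1 - Poly_Mapping.single {#b#} 1 | a b. True}
     \<union> {Poly_Mapping.single {#kform_scale c a#} 1 - Poly_Mapping.single {#a#} c | c a. True}"
      by (intro UnI2) (auto simp: push_diff kform_pullback_scale)
  qed
  with step show ?case
    by (simp add: push_add push_mult module.span_add[OF ring_module] module.span_scale[OF ring_module] module.span_base[OF ring_module])
qed

text \<open>The algebra endomorphism \<open>S\<^sup>*(g\<^sup>*)\<close> of \<open>\<W>\<close> induced by pull-back of forms along \<open>g(u) = m u + b\<close>.\<close>
lift_definition W_pullback :: "complex \<Rightarrow> complex \<Rightarrow> boson \<Rightarrow> boson"
  is "\<lambda>m b. push (kform_pullback m b)"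
  unfolding sym_eq_def by (subst push_diff[symmetric]) (rule push_pullback_sym_ideal)

lemma W_pullback_kgen: "W_pullback m b (kgen a) = kgen (kform_pullback m b a)"
  by (simp add: W_pullback.abs_eq kgen.abs_eq)

lemma W_pullback_one: "W_pullback m b 1 = 1"
  using push_single[of "kform_pullback m b" "{#}" 1]
  by (simp add: W_pullback.abs_eq one_boson.abs_eq single_empty_one)

lemma W_pullback_add: "W_pullback m b (x + y) = W_pullback m b x + W_pullback m b y"
  using abs_boson_cases[of x] abs_boson_cases[of y]
  by (auto simp: W_pullback.abs_eq plus_boson.abs_eq push_add)

lemma W_pullback_mult: "W_pullback m b (x * y) = W_pullback m b x * W_pullback m b y"
  using abs_boson_cases[of x] abs_boson_cases[of y]
  by (auto simp: W_pullback.abs_eq times_boson.abs_eq push_mult)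

lemma W_pullback_scale: "W_pullback m b (boson_scale c x) = boson_scale c (W_pullback m b x)"
  using abs_boson_cases[of x]
  by (auto simp: W_pullback.abs_eq boson_scale.abs_eq push_mult)

definition W_translate :: "complex \<Rightarrow> boson \<Rightarrow> boson" where
  "W_translate v = W_pullback 1 (- v)"

definition rotate_point :: "complex \<Rightarrow> complex \<Rightarrow> complex \<Rightarrow> complex" where
  "rotate_point p l z = p + l * (z - p)"

text \<open>Pull-back along \<open>rotate_point p (1/l)\<close>, the inverse of \<open>rotate_point p l\<close>.\<close>
definition W_rotate :: "complex \<Rightarrow> complex \<Rightarrow> boson \<Rightarrow> boson" where
  "W_rotate p l = W_pullback (inverse l) (p - inverse l * p)"


section \<open>Vertex algebra structures\<close>

text \<open>
  \<open>Y S x v\<close> is the operator \<open>Y(x, v)\<close> for \<open>x\<close> regarded as an element of \<open>W_poles_in S\<close>. It is only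
  constrained, and only meaningful, for finite \<open>S\<close>, for \<open>x \<in> W_poles_in S\<close> and on the domain
  \<open>W_regular_on ((+) v ` S)\<close>. Enlarging \<open>S\<close> restricts the operator to a smaller domain.
\<close>
locale boson_vertex_algebra =
  fixes Y :: "complex set \<Rightarrow> boson \<Rightarrow> complex \<Rightarrow> boson \<Rightarrow> boson"
  assumes operator_add:
      "\<lbrakk>finite S; x \<in> W_poles_in S; w \<in> W_regular_on ((+) v ` S); w' \<in> W_regular_on ((+) v ` S)\<rbrakk>
        \<Longrightarrow> Y S x v (w + w') = Y S x v w + Y S x v w'"
    and operator_scale:
      "\<lbrakk>finite S; x \<in> W_poles_in S; w \<in> W_regular_on ((+) v ` S)\<rbrakk>
        \<Longrightarrow> Y S x v (boson_scale c w) = boson_scale c (Y S x v w)"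
    and state_add:
      "\<lbrakk>finite S; x \<in> W_poles_in S; x' \<in> W_poles_in S; w \<in> W_regular_on ((+) v ` S)\<rbrakk>
        \<Longrightarrow> Y S (x + x') v w = Y S x v w + Y S x' v w"
    and state_scale:
      "\<lbrakk>finite S; x \<in> W_poles_in S; w \<in> W_regular_on ((+) v ` S)\<rbrakk>
        \<Longrightarrow> Y S (boson_scale c x) v w = boson_scale c (Y S x v w)"
    and enlarge:
      "\<lbrakk>finite S'; S \<subseteq> S'; x \<in> W_poles_in S; w \<in> W_regular_on ((+) v ` S')\<rbrakk>
        \<Longrightarrow> Y S' x v w = Y S x v w"
    and poles:
      "\<lbrakk>finite S; finite S'; x \<in> W_poles_in S; x' \<in> W_poles_in S'; x' \<in> W_regular_on ((+) v ` S)\<rbrakk>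
        \<Longrightarrow> Y S x v x' \<in> W_poles_in (S' \<union> (+) v ` S)"
    and vacuum:
      "\<lbrakk>finite S; w \<in> W_regular_on ((+) v ` S)\<rbrakk> \<Longrightarrow> Y S 1 v w = w"
    and creation:
      "\<lbrakk>finite S; x \<in> W_poles_in S\<rbrakk> \<Longrightarrow> Y S x 0 1 = x"
    and locality:
      "\<lbrakk>finite S; finite S'; x \<in> W_poles_in S; x' \<in> W_poles_in S'; (+) v ` S \<inter> (+) v' ` S' = {};
        w \<in> W_regular_on ((+) v ` S); w \<in> W_regular_on ((+) v' ` S');
        Y S' x' v' w \<in> W_regular_on ((+) v ` S); Y S x v w \<in> W_regular_on ((+) v' ` S')\<rbrakk>
        \<Longrightarrow> Y S x v (Y S' x' v' w) = Y S' x' v' (Y S x v w)"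
    and translation:
      "\<lbrakk>finite S; x \<in> W_poles_in S; w \<in> W_regular_on ((+) (v + v') ` S)\<rbrakk>
        \<Longrightarrow> Y S x (v + v') w = W_translate v' (Y S x v (W_translate (- v') w))"
    and translation_covariance:
      "\<lbrakk>finite S; x \<in> W_poles_in S; w \<in> W_regular_on ((+) (v + v') ` S)\<rbrakk>
        \<Longrightarrow> Y ((+) v' ` S) (W_translate v' x) v w = W_translate v' (Y S x v (W_translate (- v') w))"
    and rotation_covariance:
      "\<lbrakk>finite S; x \<in> W_poles_in S; l \<noteq> 0; w \<in> W_regular_on (rotate_point p l ` (+) v ` S)\<rbrakk>
        \<Longrightarrow> Y (rotate_point p l ` S) (W_rotate p l x) (l * v) w =
              W_rotate p l (Y S x v (W_rotate p (inverse l) w))"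
    \<comment> \<open>By covariance this holds for one point \<open>p\<close> iff it holds for all points.\<close>
    and spanning:
      "\<exists>p. boson.span {foldr (\<lambda>(x, v). Y {p} x v) xvs 1 | xvs.
             distinct (map snd xvs) \<and> fst ` set xvs \<subseteq> W_poles_in {p}} = UNIV"

end

theory Submission
  imports Defs
begin

text \<open>
  By creation, \<open>x2 = Y(x2, 0) 1\<close>, so locality moves \<open>Y(x1, v)\<close> onto the vacuum, where it gives
  \<open>T\<^sub>v x1\<close>. Conjugating \<open>Y(x2, 0)\<close> by \<open>T\<^sub>v\<close> then turns \<open>Y(x2, 0) T\<^sub>v x1\<close> into \<open>T\<^sub>v Y(x2, -v) x1\<close>.
\<close>

lemma push_push: "push f (push g p) = push (f \<circ> g) p"
  by (induction p rule: poly_mapping_single_induct)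
     (simp_all add: push_add multiset.map_comp comp_def)

lemma push_id: "push id p = p"
  by (induction p rule: poly_mapping_single_induct) (simp_all add: push_add)

lemma kform_pullback_translations:
  "kform_pullback 1 b \<circ> kform_pullback 1 (- b) = id"
  by (rule ext) (simp add: coeff_fun_inject[symmetric] kform_pullback.rep_eq)

text \<open>Pull-back lifts functorially through \<open>push\<close>, so it suffices that opposite
  translations cancel on coefficient functions.\<close>

lemma W_translate_inverse: "W_translate v (W_translate (- v) x) = x"
  using abs_boson_cases[of x] kform_pullback_translations[of "- v"]
  by (auto simp: W_translate_def W_pullback.abs_eq push_push push_id)

lemma W_translate_one: "W_translate v 1 = 1"
  by (simp add: W_translate_def W_pullback_one)

lemma sym_sub_mono: "A \<subseteq> B \<Longrightarrow> sym_sub A \<subseteq> sym_sub B"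
  unfolding sym_sub_def by (intro boson.span_mono) blast

lemma one_in_sym_sub: "1 \<in> sym_sub A"
  unfolding sym_sub_def by (intro boson.span_base CollectI exI[of _ "{#}"]) simp

text \<open>A form with all poles in \<open>S\<close> has none on \<open>T\<close>, so the
  generating forms are included; disjointness thus becomes a domain condition.\<close>

lemma W_poles_in_imp_regular_on:
  "\<lbrakk>x \<in> W_poles_in S; S \<inter> T = {}\<rbrakk> \<Longrightarrow> x \<in> W_regular_on T"
  unfolding W_poles_in_def W_regular_on_def by (rule subsetD[OF sym_sub_mono]) auto

lemma one_poles_in: "1 \<in> W_poles_in S"
  and one_regular_on: "1 \<in> W_regular_on S"
  by (simp_all add: W_poles_in_def W_regular_on_def one_in_sym_sub)

context boson_vertex_algebra
begin

text \<open>Conjugate the creation axiom from \<open>0\<close> to \<open>v\<close>; the vacuum is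
  fixed by every translation.\<close>

lemma Y_one:
  assumes "finite S" "x \<in> W_poles_in S"
  shows "Y S x v 1 = W_translate v x"
  using translation[OF assms, of 1 0 v] creation[OF assms]
  by (simp add: W_translate_one one_regular_on)

text \<open>The vacuum lies in \<open>W_poles_in {}\<close>, so \<open>poles\<close> leaves room for
  poles only in the translate of \<open>S\<close>.\<close>

lemma Y_one_regular_on:
  assumes "finite S" "x \<in> W_poles_in S" "(+) v ` S \<inter> T = {}"
  shows "Y S x v 1 \<in> W_regular_on T"
  using poles[of S "{}" x 1 v] assms
  by (auto intro: W_poles_in_imp_regular_on simp: one_poles_in one_regular_on)

lemma skew_symmetry:
  assumes fin: "finite S1" "finite S2"
    and x1: "x1 \<in> W_poles_in S1" and x2: "x2 \<in> W_poles_in S2"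
    and disj: "S2 \<inter> (+) v ` S1 = {}"
  shows "Y S1 x1 v x2 = W_translate v (Y S2 x2 (- v) x1)"
proof -
  have "S1 \<inter> (+) (- v) ` S2 = {}"
  proof -
    have False if "z \<in> S2" "- v + z \<in> S1" for z
    proof -
      have "v + (- v + z) \<in> (+) v ` S1"
        using that by blast
      thus False using that disj by auto
    qed
    thus ?thesis by blast
  qed
  \<comment> \<open>Writing \<open>0 + - v\<close> lets \<open>translation\<close> express the
    operator at \<open>- v\<close> as a conjugate of the one at \<open>0\<close>.\<close>
  hence "x1 \<in> W_regular_on ((+) (0 + - v) ` S2)"
    using W_poles_in_imp_regular_on[OF x1] by simp
  from translation[OF fin(2) x2 this]
  have Y2: "Y S2 x2 (- v) x1 = W_translate (- v) (Y S2 x2 0 (W_translate v x1))"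
    by simp
  have "Y S1 x1 v x2 = Y S1 x1 v (Y S2 x2 0 1)"
    using creation[OF fin(2) x2] by simp
  \<comment> \<open>Both orders are defined: \<open>Y S2 x2 0 1\<close> is \<open>x2\<close>, with
    poles in \<open>S2\<close>, while \<open>Y S1 x1 v 1\<close> has poles only in the translate of
    \<open>S1\<close>, which misses \<open>S2\<close>.\<close>
  also have "\<dots> = Y S2 x2 0 (Y S1 x1 v 1)"
    using disj creation[OF fin(2) x2]
    by (intro locality fin x1 x2 one_regular_on)
       (auto intro: W_poles_in_imp_regular_on[OF x2] Y_one_regular_on[OF fin(1) x1])
  also have "\<dots> = W_translate v (Y S2 x2 (- v) x1)"
    by (simp add: Y2 W_translate_inverse Y_one[OF fin(1) x1])
  finally show ?thesis .
qed

end

theorem proposition10p3: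
  fixes Y :: "complex set \<Rightarrow> boson \<Rightarrow> complex \<Rightarrow> boson \<Rightarrow> boson"
    and S1 S2 :: "complex set" and x1 x2 :: boson and v :: complex
  assumes "boson_vertex_algebra Y"
    and "finite S1" and "finite S2"
    and "x1 \<in> W_poles_in S1" and "x2 \<in> W_poles_in S2"
    and "S2 \<inter> (+) v ` S1 = {}"
  shows "Y S1 x1 v x2 = W_translate v (Y S2 x2 (- v) x1)"
  using assms by (rule boson_vertex_algebra.skew_symmetry)

end
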